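(* Let $R \subset \mathbb{N}$ be a set of Bohr recurrence. Then $R$ can be partitioned into two sets of Bohr recurrence, i.e. there exist disjoint sets $A, B \subset \mathbb{N}$ with $A \cup B = R$ such that both $A$ and $B$ are sets of Bohr recurrence.
   Context: $\mathbb{N} = \{1,2,3,\ldots\}$ and $\mathbb{T} = \mathbb{R}/\mathbb{Z}$. A set $R \subset \mathbb{N}$ is called a set of Bohr recurrence if for every $d \in \mathbb{N}$ and every $\alpha \in \mathbb{T}^d$, the closure of $\{r\alpha : r \in R\}$ in $\mathbb{T}^d$ contains $0$. *)

theory Defs
  imports "HOL-Analysis.Analysis"
begin

section \<open>The group \<open>\<real>/\<int>\<close> with its quotient topology\<close>

quotient_type circle = real / "\<lambda>x y. x - y \<in> \<int>"
  morphisms rep_circle to_circle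
proof (rule equivpI)
  show "reflp (\<lambda>x y :: real. x - y \<in> \<int>)"
    by (simp add: reflp_def)
  show "symp (\<lambda>x y :: real. x - y \<in> \<int>)"
    unfolding symp_def by (metis Ints_minus minus_diff_eq)
  show "transp (\<lambda>x y :: real. x - y \<in> \<int>)"
    unfolding transp_def by (metis Ints_add add_diff_eq diff_add_cancel)
qed

instantiation circle :: ab_group_add
begin

lift_definition zero_circle :: circle is 0 .

lift_definition plus_circle :: "circle \<Rightarrow> circle \<Rightarrow> circle" is "(+)"
  by (metis Ints_add add_diff_add)

lift_definition uminus_circle :: "circle \<Rightarrow> circle" is uminus
  by (metis Ints_minus minus_diff_minus)

lift_definition minus_circle :: "circle \<Rightarrow> circle \<Rightarrow> circle" is "(-)"
  by (metis Ints_diff diff_diff_eq2 diff_add_eq diff_diff_eq add.commute)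

instance
  by standard (transfer, simp)+

end

instantiation circle :: topological_space
begin

definition open_circle :: "circle set \<Rightarrow> bool" where
  "open_circle U \<longleftrightarrow> open (to_circle -` U)"

instance
  by standard (auto simp: open_circle_def vimage_Union)

end

section \<open>Sets of Bohr recurrence\<close>

text \<open>
  A point of the torus of dimension \<open>d\<close> is an element of \<open>{..<d} \<rightarrow>\<^sub>E UNIV\<close>, that is, a
  function that is \<open>undefined\<close> outside \<open>{..<d}\<close>.
\<close>

definition torus :: "nat \<Rightarrow> (nat \<Rightarrow> circle) topology" where
  "torus d = product_topology (\<lambda>_. euclidean) {..<d}"

definition torus_zero :: "nat \<Rightarrow> nat \<Rightarrow> circle" where
  "torus_zero d = (\<lambda>i\<in>{..<d}. 0)"

definition torus_mult :: "nat \<Rightarrow> nat \<Rightarrow> (nat \<Rightarrow> circle) \<Rightarrow> nat \<Rightarrow> circle" where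
  "torus_mult d r \<alpha> = (\<lambda>i\<in>{..<d}. \<Sum>_<r. \<alpha> i)"

definition bohr_recurrence :: "nat set \<Rightarrow> bool" where
  "bohr_recurrence R \<longleftrightarrow>
     R \<subseteq> {1..} \<and>
     (\<forall>d\<ge>1. \<forall>\<alpha>\<in>topspace (torus d).
        torus_zero d \<in> torus d closure_of {torus_mult d r \<alpha> |r. r \<in> R})"

lemma sum_const_to_circle: "(\<Sum>_<r. to_circle x) = to_circle (real r * x)"
  by (induction r) (simp_all add: zero_circle.abs_eq plus_circle.abs_eq algebra_simps)

end

theory Submission imports Defs
begin

text \<open>
  Bohr recurrence of \<open>R\<close> is a countable list of demands: with \<open>zero_nbhd n\<close> a shrinking base of
  neighbourhoods of \<open>0\<close> in the circle, the \<open>n\<close>-th demand is that every \<open>\<alpha>\<close> in the \<open>n\<close>-dimensional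
  torus has some \<open>r \<in> R\<close> with all coordinates of \<open>r\<alpha>\<close> in \<open>zero_nbhd n\<close>.

  Two facts make the partition possible. First, the torus is compact, and for each \<open>r\<close> the set of
  \<open>\<alpha>\<close> that \<open>r\<close> serves is open, so each single demand is already met by a finite subset of \<open>R\<close>
  (\<open>recurs_finite_subset\<close>). Second, deleting a finite set \<open>F\<close> from \<open>R\<close> does no harm
  (\<open>recurs_Diff_finite\<close>): adjoining a coordinate \<open>1/m\<close> to \<open>\<alpha>\<close> forces \<open>r\<close> to be a multiple of \<open>m\<close>,
  hence outside \<open>F\<close> once \<open>m\<close> is larger than every element of \<open>F\<close>.

  So finite subsets meeting the demands can be chosen one after another, each disjoint from
  the earlier ones and with every demand met twice. Giving these blocks alternately to \<open>A\<close> and to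
  its complement in \<open>R\<close> proves the theorem (\<open>split_by_finite_blocks\<close>).
\<close>

definition zero_nbhd :: "nat \<Rightarrow> circle set" where
  "zero_nbhd n = to_circle ` ball 0 (1 / (real n + 1))"

text \<open>
  One parameter controls both the dimension and the size of the neighbourhood; the family of
  demands is then indexed by \<open>nat\<close>. Points are arbitrary functions, of which only the first \<open>n\<close>
  values matter.
\<close>

definition recurs :: "nat \<Rightarrow> nat set \<Rightarrow> bool" where
  "recurs n R \<longleftrightarrow> (\<forall>\<alpha> :: nat \<Rightarrow> circle. \<exists>r\<in>R. \<forall>i<n. (\<Sum>_<r. \<alpha> i) \<in> zero_nbhd n)"

section \<open>The topology of the circle\<close>

lemma to_circle_eq_iff: "to_circle x = to_circle y \<longleftrightarrow> x - y \<in> \<int>"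
  by (rule circle.abs_eq_iff)

lemma to_circle_surj: "\<exists>x. to_circle x = c"
  by (metis Quotient3_abs_rep[OF Quotient3_circle])

lemma continuous_on_to_circle: "continuous_on S to_circle"
  by (rule continuous_on_subset[of UNIV])
     (auto simp: continuous_on_open_vimage open_circle_def)

lemma to_circle_vimage_image: "to_circle -` (to_circle ` U) = (\<Union>k\<in>\<int>. (+) k ` U)"
proof (intro set_eqI iffI)
  fix y assume "y \<in> to_circle -` (to_circle ` U)"
  then obtain x where "x \<in> U" "y - x \<in> \<int>"
    by (auto simp: to_circle_eq_iff)
  then show "y \<in> (\<Union>k\<in>\<int>. (+) k ` U)"
    by (intro UN_I[of "y - x"] image_eqI[of _ _ x]) auto
next
  fix y assume "y \<in> (\<Union>k\<in>\<int>. (+) k ` U)"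
  then obtain k x where "k \<in> \<int>" "x \<in> U" "y = k + x" by auto
  then have "to_circle y = to_circle x" by (simp add: to_circle_eq_iff)
  with \<open>x \<in> U\<close> show "y \<in> to_circle -` (to_circle ` U)" by auto
qed

lemma open_to_circle_image: "open U \<Longrightarrow> open (to_circle ` U)"
  unfolding open_circle_def to_circle_vimage_image by (intro open_UN ballI open_translation)

lemma compact_UNIV_circle: "compact (UNIV :: circle set)"
proof -
  have "c \<in> to_circle ` {0..1}" for c
  proof -
    obtain x where x: "to_circle x = c" using to_circle_surj by blast
    then have "to_circle (frac x) = c"
      by (auto simp: frac_def to_circle_eq_iff)
    then show ?thesis
      by (metis atLeastAtMost_iff frac_ge_0 frac_lt_1 image_eqI less_imp_le)
  qed
  then have "(UNIV :: circle set) = to_circle ` {0..1}" by auto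
  moreover have "compact (to_circle ` {0..1})"
    by (rule compact_continuous_image[OF continuous_on_to_circle compact_Icc])
  ultimately show ?thesis by metis
qed

lemma open_multiple_vimage:
  fixes U :: "circle set" and r :: nat
  assumes "open U"
  shows "open {c. (\<Sum>_<r. c) \<in> U}"
proof -
  have "to_circle -` {c. (\<Sum>_<r. c) \<in> U} = (\<lambda>x. real r * x) -` (to_circle -` U)"
    by (auto simp: sum_const_to_circle)
  moreover have "open ((\<lambda>x. real r * x) -` (to_circle -` U))"
    by (rule open_vimage[OF assms[unfolded open_circle_def]]) (intro continuous_intros)
  ultimately show ?thesis by (simp add: open_circle_def)
qed

lemma open_zero_nbhd: "open (zero_nbhd n)"
  by (simp add: zero_nbhd_def open_to_circle_image)

lemma zero_in_zero_nbhd: "0 \<in> zero_nbhd n"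
  unfolding zero_nbhd_def zero_circle.abs_eq by (intro imageI) simp

lemma zero_nbhd_antimono:
  assumes "m \<le> n"
  shows "zero_nbhd n \<subseteq> zero_nbhd m"
  unfolding zero_nbhd_def using assms by (intro image_mono subset_ball frac_le) auto

lemma zero_nbhd_base:
  assumes "open U" "(0 :: circle) \<in> U"
  obtains n where "zero_nbhd n \<subseteq> U"
proof -
  have "open (to_circle -` U)" "0 \<in> to_circle -` U"
    using assms by (auto simp: open_circle_def zero_circle.abs_eq)
  then obtain e where e: "e > 0" "ball 0 e \<subseteq> to_circle -` U"
    using open_contains_ball by blast
  obtain n where "1 / (real n + 1) < e"
    using nat_approx_posE[OF e(1)] by (auto simp: add.commute)
  then have "ball 0 (1 / (real n + 1)) \<subseteq> to_circle -` U"
    using e(2) subset_ball[of "1 / (real n + 1)" e "0 :: real"] by auto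
  then have "zero_nbhd n \<subseteq> U" unfolding zero_nbhd_def by auto
  then show thesis by (rule that)
qed

section \<open>Bohr recurrence as a sequence of demands\<close>

lemma recurs_mono: "recurs n R \<Longrightarrow> R \<subseteq> S \<Longrightarrow> recurs n S"
  unfolding recurs_def by (meson subsetD)

lemma recurs_of_bohr_recurrence:
  assumes "bohr_recurrence R"
  shows "recurs n R"
  unfolding recurs_def
proof
  fix \<alpha> :: "nat \<Rightarrow> circle"
  \<comment> \<open>Bohr recurrence speaks of dimensions at least \<open>1\<close> only; dimension \<open>Suc n\<close> covers \<open>n = 0\<close>.\<close>
  define d where "d = Suc n"
  define a where "a = restrict \<alpha> {..<d}"
  have a: "a \<in> topspace (torus d)"
    by (simp add: a_def torus_def)
  have "torus_zero d \<in> torus d closure_of {torus_mult d r a |r. r \<in> R}"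
    using assms a unfolding bohr_recurrence_def d_def by auto
  moreover have "openin (torus d) (PiE {..<d} (\<lambda>_. zero_nbhd n))"
    unfolding torus_def by (simp add: openin_PiE_gen open_zero_nbhd)
  moreover have "torus_zero d \<in> PiE {..<d} (\<lambda>_. zero_nbhd n)"
    by (auto simp: torus_zero_def zero_in_zero_nbhd)
  ultimately obtain r where r: "r \<in> R" "torus_mult d r a \<in> PiE {..<d} (\<lambda>_. zero_nbhd n)"
    unfolding in_closure_of by blast
  have "(\<Sum>_<r. \<alpha> i) \<in> zero_nbhd n" if "i < n" for i
  proof -
    have "i < d" using that by (simp add: d_def)
    then show ?thesis
      using PiE_mem[OF r(2), of i] by (simp add: torus_mult_def a_def)
  qed
  then show "\<exists>r\<in>R. \<forall>i<n. (\<Sum>_<r. \<alpha> i) \<in> zero_nbhd n" using r(1) by blast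
qed

lemma bohr_recurrence_of_recurs:
  assumes "R \<subseteq> {1..}" and rec: "\<And>n. recurs n R"
  shows "bohr_recurrence R"
  unfolding bohr_recurrence_def
proof (intro conjI allI impI ballI)
  show "R \<subseteq> {1..}" by fact
  fix d :: nat and \<alpha> assume \<alpha>: "\<alpha> \<in> topspace (torus d)"
  have zero: "torus_zero d \<in> topspace (torus d)"
    by (simp add: torus_def torus_zero_def)
  have "\<exists>y. y \<in> {torus_mult d r \<alpha> |r. r \<in> R} \<and> y \<in> T"
    if T: "torus_zero d \<in> T" "openin (torus d) T" for T
  proof -
    have "\<exists>U. (\<forall>i<d. open (U i)) \<and> torus_zero d \<in> PiE {..<d} U \<and> PiE {..<d} U \<subseteq> T"
      using T by (simp add: torus_def openin_product_topology_alt Ball_def)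
    then obtain U where U: "\<And>i. i < d \<Longrightarrow> open (U i)"
        "torus_zero d \<in> PiE {..<d} U" "PiE {..<d} U \<subseteq> T"
      by blast
    have "\<exists>n. zero_nbhd n \<subseteq> U i" if "i < d" for i
    proof -
      have "0 \<in> U i" using PiE_mem[OF U(2), of i] that by (simp add: torus_zero_def)
      with U(1)[OF that] show ?thesis using zero_nbhd_base by metis
    qed
    then obtain f where f: "\<And>i. i < d \<Longrightarrow> zero_nbhd (f i) \<subseteq> U i" by metis
    \<comment> \<open>The index must be at least \<open>d\<close> for the dimension and at least every \<open>f i\<close> for the box.\<close>
    define n where "n = d + (\<Sum>i<d. f i)"
    obtain r where r: "r \<in> R" "\<And>i. i < n \<Longrightarrow> (\<Sum>_<r. \<alpha> i) \<in> zero_nbhd n"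
      using rec[of n] unfolding recurs_def by blast
    have "(\<Sum>_<r. \<alpha> i) \<in> U i" if "i < d" for i
    proof -
      have "f i \<le> (\<Sum>i<d. f i)" using that by (intro member_le_sum) auto
      then have "zero_nbhd n \<subseteq> zero_nbhd (f i)"
        by (intro zero_nbhd_antimono) (simp add: n_def)
      moreover have "i < n" using that by (simp add: n_def)
      ultimately show ?thesis using f[OF that] r(2) by blast
    qed
    then have "torus_mult d r \<alpha> \<in> PiE {..<d} U"
      by (auto simp: torus_mult_def)
    then show ?thesis using U(3) r(1) by blast
  qed
  then show "torus_zero d \<in> torus d closure_of {torus_mult d r \<alpha> |r. r \<in> R}"
    unfolding in_closure_of using zero by blast
qed

section \<open>Finite subsets\<close>

text \<open>
  Compactness of the torus: the points served by a given \<open>r \<in> R\<close> form an open box, and the demand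
  says that these boxes cover the torus.
\<close>

lemma recurs_finite_subset:
  assumes "recurs n R"
  obtains F where "finite F" "F \<subseteq> R" "recurs n F"
proof -
  define S where "S r = PiE {..<n} (\<lambda>_. {c. (\<Sum>_<r. c) \<in> zero_nbhd n})" for r :: nat
  have "compactin (torus n) (topspace (torus n))"
    unfolding torus_def compact_space_def[symmetric] compact_space_product_topology
    using compact_UNIV_circle by (simp add: compact_space_def)
  moreover have "openin (torus n) (S r)" for r
    unfolding torus_def S_def
    by (simp add: openin_PiE_gen open_multiple_vimage open_zero_nbhd)
  moreover have "topspace (torus n) \<subseteq> \<Union> (S ` R)"
  proof
    fix \<alpha> assume "\<alpha> \<in> topspace (torus n)"
    then have "\<alpha> \<in> extensional {..<n}" by (simp add: torus_def PiE_def)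
    moreover obtain r where "r \<in> R" "\<forall>i<n. (\<Sum>_<r. \<alpha> i) \<in> zero_nbhd n"
      using assms unfolding recurs_def by blast
    ultimately show "\<alpha> \<in> \<Union> (S ` R)" by (auto simp: S_def PiE_def)
  qed
  ultimately obtain \<F> where "finite \<F>" "\<F> \<subseteq> S ` R" "topspace (torus n) \<subseteq> \<Union>\<F>"
    unfolding compactin_def by (smt (verit) imageE)
  then obtain F where F: "finite F" "F \<subseteq> R" "topspace (torus n) \<subseteq> \<Union> (S ` F)"
    by (metis finite_subset_image)
  have "recurs n F"
    unfolding recurs_def
  proof
    fix \<alpha> :: "nat \<Rightarrow> circle"
    have "restrict \<alpha> {..<n} \<in> topspace (torus n)" by (simp add: torus_def)
    then obtain r where r: "r \<in> F" "restrict \<alpha> {..<n} \<in> S r" using F(3) by blast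
    have "(\<Sum>_<r. \<alpha> i) \<in> zero_nbhd n" if "i < n" for i
      using PiE_mem[OF r(2)[unfolded S_def], of i] that by simp
    then show "\<exists>r\<in>F. \<forall>i<n. (\<Sum>_<r. \<alpha> i) \<in> zero_nbhd n" using r(1) by blast
  qed
  with F(1,2) show thesis by (rule that)
qed

text \<open>
  Multiples of the point \<open>1/m\<close> are fractions with denominator \<open>m\<close>, so such a multiple
  at distance less than \<open>1/m\<close> from \<open>0\<close> is \<open>0\<close>.
\<close>

lemma dvd_of_multiple_in_zero_nbhd:
  assumes "m > 0" "m \<le> n + 1" "(\<Sum>_<r. to_circle (1 / real m)) \<in> zero_nbhd n"
  shows "m dvd r"
proof -
  obtain y where y: "to_circle (real r / real m) = to_circle y" "\<bar>y\<bar> < 1 / (real n + 1)"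
    using assms(3) by (auto simp: sum_const_to_circle zero_nbhd_def)
  then obtain k where k: "real r / real m - y = of_int k"
    by (auto simp: to_circle_eq_iff elim: Ints_cases)
  have "1 / (real n + 1) \<le> 1 / real m"
    using assms(1,2) by (intro frac_le) auto
  with y(2) have "\<bar>y\<bar> < 1 / real m" by linarith
  then have "\<bar>y * real m\<bar> < 1"
    using assms(1) by (simp add: abs_mult field_simps)
  moreover have "y * real m = of_int (int r - k * int m)"
    using k assms(1) by (simp add: field_simps)
  ultimately have "\<bar>int r - k * int m\<bar> < 1"
    by (metis of_int_abs of_int_less_1_iff)
  then have "int r = k * int m" by linarith
  then show ?thesis
    by (metis dvd_triv_right int_dvd_int_iff)
qed

text \<open>
  An extra coordinate \<open>1/m\<close> can only be brought near \<open>0\<close> by multiples of \<open>m\<close>. With \<open>m\<close> above all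
  of \<open>F\<close>, and \<open>r = 0\<close> excluded, such multiples avoid \<open>F\<close>.
\<close>

lemma recurs_Diff_finite:
  assumes "R \<subseteq> {1..}" "finite F" and rec: "\<And>n. recurs n R"
  shows "recurs n (R - F)"
  unfolding recurs_def
proof
  fix \<alpha> :: "nat \<Rightarrow> circle"
  obtain m where m: "\<And>r. r \<in> F \<Longrightarrow> r < m" "m > 0"
    using finite_nat_set_iff_bounded assms(2)
    by (metis gr_zeroI less_Suc_eq zero_less_Suc)
  define \<beta> where "\<beta> i = (if i < n then \<alpha> i else to_circle (1 / real m))" for i
  obtain r where r: "r \<in> R" "\<And>i. i < n + m \<Longrightarrow> (\<Sum>_<r. \<beta> i) \<in> zero_nbhd (n + m)"
    using rec[of "n + m"] unfolding recurs_def by blast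
  have "m dvd r"
    using dvd_of_multiple_in_zero_nbhd[of m "n + m" r] r(2)[of n] m(2) by (simp add: \<beta>_def)
  moreover have "r > 0" using r(1) assms(1) by auto
  ultimately have "m \<le> r" by (simp add: dvd_imp_le)
  then have "r \<notin> F" using m(1) by fastforce
  moreover have "(\<Sum>_<r. \<alpha> i) \<in> zero_nbhd n" if "i < n" for i
    using r(2)[of i] that zero_nbhd_antimono[of n "n + m"] by (auto simp: \<beta>_def)
  ultimately show "\<exists>r\<in>R - F. \<forall>i<n. (\<Sum>_<r. \<alpha> i) \<in> zero_nbhd n" using r(1) by blast
qed

section \<open>Splitting along disjoint finite blocks\<close>

text \<open>
  An increasing sequence of finite sets \<open>G k\<close> is built so that the block \<open>G (Suc k) - G k\<close> meets
  demand \<open>k div 2\<close>. Each demand is thus met by an even-numbered block, which goes to the first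
  part, and by an odd-numbered one, which is left to the second.
\<close>

lemma split_by_finite_blocks:
  fixes P :: "nat \<Rightarrow> 'a set \<Rightarrow> bool"
  assumes mono: "\<And>n S T. P n S \<Longrightarrow> S \<subseteq> T \<Longrightarrow> P n T"
    and block: "\<And>n F. finite F \<Longrightarrow> \<exists>E. finite E \<and> E \<subseteq> R - F \<and> P n E"
  shows "\<exists>A\<subseteq>R. \<forall>n. P n A \<and> P n (R - A)"
proof -
  have "\<exists>G. \<forall>k. (finite (G k) \<and> G k \<subseteq> R) \<and>
      (G k \<subseteq> G (Suc k) \<and> P (k div 2) (G (Suc k) - G k))"
  proof (rule dependent_nat_choice)
    show "\<exists>X. finite X \<and> X \<subseteq> R" by blast
    fix X k assume X: "finite X \<and> X \<subseteq> R"
    then obtain E where E: "finite E" "E \<subseteq> R - X" "P (k div 2) E"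
      using block[of X "k div 2"] by auto
    have "X \<union> E - X = E" using E(2) by blast
    then show "\<exists>Y. (finite Y \<and> Y \<subseteq> R) \<and> (X \<subseteq> Y \<and> P (k div 2) (Y - X))"
      using X E by (intro exI[of _ "X \<union> E"]) auto
  qed
  then obtain G where G: "\<And>k. G k \<subseteq> R" "\<And>k. G k \<subseteq> G (Suc k)"
      "\<And>k. P (k div 2) (G (Suc k) - G k)" by blast
  have G_mono: "G i \<subseteq> G j" if "i \<le> j" for i j
    using that G(2) by (rule lift_Suc_mono_le[rotated])
  define B where "B k = G (Suc k) - G k" for k
  have disj: "B i \<inter> B j = {}" if "i \<noteq> j" for i j
  proof (cases "i < j")
    case True
    then show ?thesis using G_mono[of "Suc i" j] by (auto simp: B_def)
  next
    case False
    with that show ?thesis using G_mono[of "Suc j" i] by (auto simp: B_def)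
  qed
  define A where "A = (\<Union>k. B (2 * k))"
  have "P n A" for n
    using mono[OF G(3)[of "2 * n"], of A] by (auto simp: A_def B_def)
  moreover have "P n (R - A)" for n
  proof -
    have "B (2 * n + 1) \<inter> B (2 * k) = {}" for k
      by (rule disj) presburger
    then have "B (2 * n + 1) \<subseteq> R - A"
      using G(1) by (auto simp: A_def B_def)
    then show ?thesis using mono[OF G(3)[of "2 * n + 1"]] by (simp add: B_def)
  qed
  moreover have "A \<subseteq> R" using G(1) by (auto simp: A_def B_def)
  ultimately show ?thesis by blast
qed

theorem proposition1p4:
  fixes R :: "nat set"
  assumes "bohr_recurrence R"
  shows "\<exists>A B. A \<inter> B = {} \<and> A \<union> B = R \<and> bohr_recurrence A \<and> bohr_recurrence B"
proof -
  have R: "R \<subseteq> {1..}" using assms by (simp add: bohr_recurrence_def)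
  have "\<exists>E. finite E \<and> E \<subseteq> R - F \<and> recurs n E" if "finite F" for n F
    using recurs_Diff_finite[OF R that recurs_of_bohr_recurrence[OF assms]]
      recurs_finite_subset by metis
  then obtain A where A: "A \<subseteq> R" "\<And>n. recurs n A" "\<And>n. recurs n (R - A)"
    using split_by_finite_blocks[of recurs R] recurs_mono by metis
  have "bohr_recurrence A" "bohr_recurrence (R - A)"
    using A R by (auto intro!: bohr_recurrence_of_recurs)
  then show ?thesis using A(1) by (intro exI[of _ A] exI[of _ "R - A"]) auto
qed

end
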